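(* Let $\mathscr{L}(L^2(I,\mathbb{R}^d))$ be the space of bounded linear operators on $L^2(I,\mathbb{R}^d)$. The map $\lambda_2:\mathscr{L}(L^2(I,\mathbb{R}^d))\to\mathbb{R}$ defined by $$\lambda_2(T):=\inf_{x\in\mathscr{C}^\perp\setminus\{0\}}\frac{\langle Tx,x\rangle_{L^2(I,\mathbb{R}^d)}}{\|x\|_{L^2(I,\mathbb{R}^d)}^2}$$ is concave. In particular, given a time-dependent operator $T\in L^2_{\mathrm{loc}}(\mathbb{R}_+,\mathscr{L}(L^2(I,\mathbb{R}^d)))$ and $\tau>0$, it holds that $$\frac1\tau\int_t^{t+\tau}\lambda_2(T(s))\,\mathrm{d}s\leq\lambda_2\Big(\frac1\tau\int_t^{t+\tau}T(s)\,\mathrm{d}s\Big)\qquad\text{for all } t\geq 0 .$$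
   Context: $I:=[0,1]$ with the Lebesgue measure, $d\geq 1$ is an integer, $\mathbb{R}_+=[0,+\infty)$. $\mathscr{C}\subset L^2(I,\mathbb{R}^d)$ is the subspace of constant functions, and $\mathscr{C}^\perp=\{x\in L^2(I,\mathbb{R}^d):\int_I x(i)\,\mathrm{d}i=0\}$ is its orthogonal complement. The space $L^2_{\mathrm{loc}}(\mathbb{R}_+,\mathscr{L}(L^2(I,\mathbb{R}^d)))$ and the integral of $T$ are understood in the sense of Bochner. *)

theory Defs
  imports "HOL-Analysis.Analysis"
begin

abbreviation unit_leb :: "real measure"
  where "unit_leb \<equiv> lebesgue_on {0..1}"

definition square_int :: "(real \<Rightarrow> 'b::euclidean_space) \<Rightarrow> bool"
  where "square_int f \<longleftrightarrow>
    f \<in> borel_measurable unit_leb \<and> integrable unit_leb (\<lambda>i. (norm (f i))\<^sup>2)"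

lemma square_intI:
  assumes "f \<in> borel_measurable unit_leb" "integrable unit_leb (\<lambda>i. (norm (f i))\<^sup>2)"
  shows "square_int f"
  using assms by (simp add: square_int_def)

lemma square_int_measurable: "square_int f \<Longrightarrow> f \<in> borel_measurable unit_leb"
  by (simp add: square_int_def)

lemma finite_unit_leb: "finite_measure unit_leb"
  by (rule finite_measure_lebesgue_on) simp

lemma measure_unit_leb: "measure unit_leb {0..1} = 1" "space unit_leb = {0..1}"
  by (auto simp: measure_restrict_space)

lemma square_int_const: "square_int (\<lambda>_. c)"
  using finite_measure.integrable_const[OF finite_unit_leb] by (auto intro: square_intI)

lemma square_int_inner:
  assumes "square_int f" "square_int g"
  shows "integrable unit_leb (\<lambda>i. f i \<bullet> g i)"
proof (rule Bochner_Integration.integrable_bound)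
  show "integrable unit_leb (\<lambda>i. (norm (f i))\<^sup>2 + (norm (g i))\<^sup>2)"
    using assms by (auto simp: square_int_def)
  show "(\<lambda>i. f i \<bullet> g i) \<in> borel_measurable unit_leb"
    using assms by (auto simp: square_int_def)
  have "\<bar>f i \<bullet> g i\<bar> \<le> (norm (f i))\<^sup>2 + (norm (g i))\<^sup>2" for i
  proof -
    have "\<bar>f i \<bullet> g i\<bar> \<le> norm (f i) * norm (g i)" by (rule Cauchy_Schwarz_ineq2)
    moreover have "0 \<le> (norm (f i) - norm (g i))\<^sup>2" by simp
    moreover have "0 \<le> norm (f i) * norm (g i)" by simp
    ultimately show ?thesis by (simp add: power2_diff)
  qed
  then show "AE i in unit_leb. norm (f i \<bullet> g i) \<le> norm ((norm (f i))\<^sup>2 + (norm (g i))\<^sup>2)"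
    by (intro always_eventually) (metis abs_of_nonneg real_norm_def sum_power2_ge_zero)
qed

lemma square_int_integrable:
  assumes "square_int f"
  shows "integrable unit_leb f"
proof (rule Bochner_Integration.integrable_bound)
  show "integrable unit_leb (\<lambda>i. (norm (f i))\<^sup>2 + 1)"
    using assms finite_measure.integrable_const[OF finite_unit_leb]
    by (auto simp: square_int_def)
  show "f \<in> borel_measurable unit_leb"
    using assms by (auto simp: square_int_def)
  have "norm (f i) \<le> (norm (f i))\<^sup>2 + 1" for i
  proof -
    have "0 \<le> (norm (f i) - 1)\<^sup>2 + norm (f i)" by simp
    then show ?thesis by (simp add: power2_diff)
  qed
  then show "AE i in unit_leb. norm (f i) \<le> norm ((norm (f i))\<^sup>2 + 1)"
    by (intro always_eventually) (simp add: add_nonneg_nonneg)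
qed

lemma square_int_add:
  assumes "square_int f" "square_int g"
  shows "square_int (\<lambda>i. f i + g i)"
proof (rule square_intI)
  show "(\<lambda>i. f i + g i) \<in> borel_measurable unit_leb"
    using assms by (auto simp: square_int_def)
  have "(norm (f i + g i))\<^sup>2 = (norm (f i))\<^sup>2 + 2 * (f i \<bullet> g i) + (norm (g i))\<^sup>2" for i
    by (simp add: power2_norm_eq_inner inner_add_left inner_add_right inner_commute)
  then show "integrable unit_leb (\<lambda>i. (norm (f i + g i))\<^sup>2)"
    using assms square_int_inner[OF assms] by (auto simp: square_int_def)
qed

lemma square_int_scaleR:
  assumes "square_int f"
  shows "square_int (\<lambda>i. r *\<^sub>R f i)"
  using assms by (auto simp: square_int_def power_mult_distrib)

definition L2_rel :: "(real \<Rightarrow> 'b::euclidean_space) \<Rightarrow> (real \<Rightarrow> 'b) \<Rightarrow> bool"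
  where "L2_rel f g \<longleftrightarrow> square_int f \<and> square_int g \<and> (AE i in unit_leb. f i = g i)"

lemma part_equivp_L2_rel: "part_equivp (L2_rel :: (real \<Rightarrow> 'b::euclidean_space) \<Rightarrow> _)"
proof (rule part_equivpI)
  show "\<exists>f::real \<Rightarrow> 'b. L2_rel f f"
    using square_int_const[of "0::'b"] by (auto simp: L2_rel_def)
  show "symp (L2_rel :: (real \<Rightarrow> 'b) \<Rightarrow> _)"
    by (auto simp: symp_def L2_rel_def elim: eventually_mono)
  show "transp (L2_rel :: (real \<Rightarrow> 'b) \<Rightarrow> _)"
    by (auto simp: transp_def L2_rel_def elim: eventually_elim2)
qed

text \<open>\<open>'b L2I\<close> is \<open>L\<^sup>2([0,1], 'b)\<close>, with functions identified almost everywhere.\<close>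

quotient_type (overloaded) 'b L2I = "real \<Rightarrow> 'b::euclidean_space" / partial: L2_rel
  by (rule part_equivp_L2_rel)

instantiation L2I :: (euclidean_space) real_vector
begin

lift_definition zero_L2I :: "'a L2I" is "\<lambda>_. 0"
  by (simp add: L2_rel_def square_int_const)

lift_definition plus_L2I :: "'a L2I \<Rightarrow> 'a L2I \<Rightarrow> 'a L2I" is "\<lambda>f g i. f i + g i"
  by (auto simp: L2_rel_def intro!: square_int_add elim: eventually_elim2)

lift_definition scaleR_L2I :: "real \<Rightarrow> 'a L2I \<Rightarrow> 'a L2I" is "\<lambda>r f i. r *\<^sub>R f i"
  by (auto simp: L2_rel_def intro!: square_int_scaleR elim: eventually_mono)

definition uminus_L2I :: "'a L2I \<Rightarrow> 'a L2I" where "uminus_L2I x = (-1) *\<^sub>R x"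
definition minus_L2I :: "'a L2I \<Rightarrow> 'a L2I \<Rightarrow> 'a L2I" where "minus_L2I x y = x + (-1) *\<^sub>R y"

instance
proof
  fix x y z :: "'a L2I" and r s :: real
  show "x + y + z = x + (y + z)"
    by transfer (auto simp: L2_rel_def add.assoc intro!: square_int_add)
  show "x + y = y + x"
    by transfer (auto simp: L2_rel_def add.commute intro!: square_int_add)
  show "0 + x = x"
    by transfer (auto simp: L2_rel_def)
  show "- x + x = 0"
    unfolding uminus_L2I_def
    by transfer (auto simp: L2_rel_def intro!: square_int_const)
  show "x - y = x + - y"
    by (simp add: minus_L2I_def uminus_L2I_def)
  show "r *\<^sub>R (x + y) = r *\<^sub>R x + r *\<^sub>R y"
    by transfer (auto simp: L2_rel_def scaleR_add_right intro!: square_int_add square_int_scaleR)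
  show "(r + s) *\<^sub>R x = r *\<^sub>R x + s *\<^sub>R x"
    by transfer (auto simp: L2_rel_def scaleR_add_left intro!: square_int_add square_int_scaleR)
  show "r *\<^sub>R s *\<^sub>R x = (r * s) *\<^sub>R x"
    by transfer (auto simp: L2_rel_def intro!: square_int_scaleR)
  show "1 *\<^sub>R x = x"
    by transfer (auto simp: L2_rel_def)
qed

end

instantiation L2I :: (euclidean_space) real_inner
begin

lift_definition inner_L2I :: "'a L2I \<Rightarrow> 'a L2I \<Rightarrow> real" is "\<lambda>f g. \<integral>i. f i \<bullet> g i \<partial>unit_leb"
  by (intro integral_cong_AE)
     (auto simp: L2_rel_def square_int_def elim: eventually_elim2)

definition norm_L2I :: "'a L2I \<Rightarrow> real" where "norm_L2I x = sqrt (x \<bullet> x)"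
definition sgn_L2I :: "'a L2I \<Rightarrow> 'a L2I" where "sgn_L2I x = x /\<^sub>R norm x"
definition dist_L2I :: "'a L2I \<Rightarrow> 'a L2I \<Rightarrow> real" where "dist_L2I x y = norm (x - y)"
definition uniformity_L2I :: "('a L2I \<times> 'a L2I) filter"
  where "uniformity_L2I = (INF e\<in>{0<..}. principal {(x, y). dist x y < e})"
definition open_L2I :: "'a L2I set \<Rightarrow> bool"
  where "open_L2I U = (\<forall>x\<in>U. \<forall>\<^sub>F (x', y) in uniformity. x' = x \<longrightarrow> y \<in> U)"

instance
proof
  fix x y z :: "'a L2I" and r :: real
  show "dist x y = norm (x - y)"
    by (simp add: dist_L2I_def)
  show "sgn x = x /\<^sub>R norm x"
    by (simp add: sgn_L2I_def)
  show "uniformity = (INF e\<in>{0<..}. principal {(x::'a L2I, y). dist x y < e})"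
    by (simp add: uniformity_L2I_def)
  show "open U = (\<forall>x\<in>U. \<forall>\<^sub>F (x', y) in uniformity. x' = x \<longrightarrow> y \<in> U)" for U :: "'a L2I set"
    by (simp add: open_L2I_def)
  show "x \<bullet> y = y \<bullet> x"
    by transfer (simp add: inner_commute)
  show "(x + y) \<bullet> z = x \<bullet> z + y \<bullet> z"
    by transfer (simp add: L2_rel_def inner_add_left square_int_inner)
  show "(r *\<^sub>R x) \<bullet> y = r * (x \<bullet> y)"
    by transfer simp
  show "0 \<le> x \<bullet> x"
    by transfer simp
  show "x \<bullet> x = 0 \<longleftrightarrow> x = 0"
  proof transfer
    fix f :: "real \<Rightarrow> 'a" assume "L2_rel f f"
    then have f: "square_int f" by (simp add: L2_rel_def)
    have "(\<integral>i. f i \<bullet> f i \<partial>unit_leb) = 0 \<longleftrightarrow> (AE i in unit_leb. f i \<bullet> f i = 0)"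
      by (rule integral_nonneg_eq_0_iff_AE) (auto simp: square_int_inner f)
    then show "(\<integral>i. f i \<bullet> f i \<partial>unit_leb) = 0 \<longleftrightarrow> L2_rel f (\<lambda>_. 0)"
      by (simp add: L2_rel_def f square_int_const)
  qed
  show "norm x = sqrt (x \<bullet> x)"
    by (simp add: norm_L2I_def)
qed

end

lemma L2I_cases:
  obtains f where "square_int f" "x = abs_L2I f"
proof -
  have "square_int (rep_L2I x)"
    using Quotient_rep_reflp[OF Quotient_L2I, of x] by (simp add: L2_rel_def)
  moreover have "x = abs_L2I (rep_L2I x)"
    using Quotient_abs_rep[OF Quotient_L2I, of x] by simp
  ultimately show ?thesis using that by blast
qed

lemma abs_L2I_eq_iff:
  assumes "square_int f" "square_int g"
  shows "abs_L2I f = abs_L2I g \<longleftrightarrow> (AE i in unit_leb. f i = g i)"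
  using Quotient_rel[OF Quotient_L2I, of f g] assms by (simp add: L2_rel_def)

lemma inner_abs_L2I:
  assumes "square_int f" "square_int g"
  shows "abs_L2I f \<bullet> abs_L2I g = (\<integral>i. f i \<bullet> g i \<partial>unit_leb)"
  using assms by (simp add: inner_L2I.abs_eq L2_rel_def)

lemma norm_abs_L2I:
  assumes "square_int f"
  shows "(norm (abs_L2I f))\<^sup>2 = (\<integral>i. (norm (f i))\<^sup>2 \<partial>unit_leb)"
  using assms by (simp add: power2_norm_eq_inner inner_abs_L2I)

lemma square_int_diff:
  assumes "square_int f" "square_int g"
  shows "square_int (\<lambda>i. f i - g i)"
  using square_int_add[OF assms(1) square_int_scaleR[OF assms(2), of "-1"]] by simp

lemma diff_abs_L2I:
  assumes "square_int f" "square_int g"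
  shows "abs_L2I f - abs_L2I g = abs_L2I (\<lambda>i. f i - g i)"
proof -
  have rel: "L2_rel f f" "L2_rel g g" "L2_rel (\<lambda>i. (-1) *\<^sub>R g i) (\<lambda>i. (-1) *\<^sub>R g i)"
    using assms square_int_scaleR[OF assms(2), of "-1"] by (auto simp: L2_rel_def)
  have "abs_L2I f - abs_L2I g = abs_L2I (\<lambda>i. f i + (-1) *\<^sub>R g i)"
    unfolding minus_L2I_def scaleR_L2I.abs_eq[OF rel(2)] plus_L2I.abs_eq[OF rel(1,3)] ..
  then show ?thesis by simp
qed

lemma nn_integral_norm_diff_L2I:
  assumes "square_int f" "square_int g"
  shows "(\<integral>\<^sup>+i. ennreal ((norm (f i - g i))\<^sup>2) \<partial>unit_leb)
       = ennreal ((norm (abs_L2I f - abs_L2I g))\<^sup>2)"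
  using square_int_diff[OF assms]
  by (subst nn_integral_eq_integral)
     (auto simp: diff_abs_L2I[OF assms] norm_abs_L2I square_int_def)

text \<open>Riesz--Fischer.\<close>

instance L2I :: (euclidean_space) banach
proof
  fix X :: "nat \<Rightarrow> 'a L2I" assume X: "Cauchy X"
  have "\<exists>N. \<forall>m\<ge>N. \<forall>n\<ge>N. dist (X m) (X n) < (1/2) ^ k" for k
    using X by (auto simp: Cauchy_def)
  then obtain N where N: "\<And>k m n. m \<ge> N k \<Longrightarrow> n \<ge> N k \<Longrightarrow> dist (X m) (X n) < (1/2) ^ k"
    by metis
  define \<phi> where "\<phi> k = k + (\<Sum>j\<le>k. N j)" for k
  have mono: "strict_mono \<phi>"
    by (simp add: strict_mono_Suc_iff \<phi>_def)
  have N_le: "N k \<le> \<phi> j" if "k \<le> j" for j k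
  proof -
    have "N k \<le> (\<Sum>i\<le>j. N i)" by (rule member_le_sum) (use that in auto)
    then show ?thesis by (simp add: \<phi>_def)
  qed
  have "\<exists>f. square_int f \<and> X (\<phi> k) = abs_L2I f" for k
    using L2I_cases[of "X (\<phi> k)"] by blast
  then obtain F where F: "\<And>k. square_int (F k)" and XF: "\<And>k. X (\<phi> k) = abs_L2I (F k)"
    by metis
  have [measurable]: "F k \<in> borel_measurable unit_leb" for k
    using F by (rule square_int_measurable)
  define D where "D k i = F (Suc k) i - F k i" for k i
  have D: "square_int (D k)" for k
    unfolding D_def by (intro square_int_diff F)
  have [measurable]: "D k \<in> borel_measurable unit_leb" for k
    using D by (rule square_int_measurable)
  have F_eq: "F k i = F 0 i + (\<Sum>j<k. D j i)" for k i
    by (induction k) (auto simp: D_def)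
  have D_norm: "(\<integral>\<^sup>+i. ennreal (norm (D k i)) \<partial>unit_leb) \<le> ennreal ((1/2)^k)" for k
  proof -
    define a :: real where "a = (1/2)^k"
    have a: "a > 0" by (simp add: a_def)
    have "norm (abs_L2I (D k)) < a"
      using N[of k "\<phi> (Suc k)" "\<phi> k"] N_le[of k k] N_le[of k "Suc k"]
      by (simp add: dist_norm XF diff_abs_L2I F D_def[abs_def] a_def)
    then have *: "(\<integral>i. (norm (D k i))\<^sup>2 \<partial>unit_leb) \<le> a\<^sup>2"
      by (subst norm_abs_L2I[symmetric]) (auto intro!: D power_mono)
    have int: "integrable unit_leb (\<lambda>i. (norm (D k i))\<^sup>2)"
      using D by (simp add: square_int_def)
    have "(\<integral>i. norm (D k i) \<partial>unit_leb) \<le> (\<integral>i. (norm (D k i))\<^sup>2 / (2 * a) + a / 2 \<partial>unit_leb)"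
    proof (rule integral_mono)
      show "integrable unit_leb (\<lambda>i. norm (D k i))"
        by (intro integrable_norm square_int_integrable D)
      show "integrable unit_leb (\<lambda>i. (norm (D k i))\<^sup>2 / (2 * a) + a / 2)"
        using int finite_measure.integrable_const[OF finite_unit_leb] by auto
      show "norm (D k i) \<le> (norm (D k i))\<^sup>2 / (2 * a) + a / 2" for i
      proof -
        have "0 \<le> (norm (D k i) - a)\<^sup>2" by simp
        then have "2 * a * norm (D k i) \<le> (norm (D k i))\<^sup>2 + a\<^sup>2"
          by (simp add: power2_diff algebra_simps)
        then show ?thesis using a by (simp add: field_simps power2_eq_square)
      qed
    qed
    also have "\<dots> = (\<integral>i. (norm (D k i))\<^sup>2 \<partial>unit_leb) / (2 * a) + a / 2"
      using int finite_measure.integrable_const[OF finite_unit_leb]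
      by (simp add: measure_unit_leb measure_restrict_space)
    also have "\<dots> \<le> a\<^sup>2 / (2 * a) + a / 2"
      using * a by (intro add_right_mono divide_right_mono) auto
    also have "\<dots> = a"
      using a by (simp add: power2_eq_square)
    finally show ?thesis
      unfolding a_def
      by (subst nn_integral_eq_integral)
         (auto intro!: ennreal_leI integrable_norm[OF square_int_integrable[OF D]])
  qed
  have "(\<integral>\<^sup>+i. (\<Sum>k. ennreal (norm (D k i))) \<partial>unit_leb)
      = (\<Sum>k. \<integral>\<^sup>+i. ennreal (norm (D k i)) \<partial>unit_leb)"
    by (rule nn_integral_suminf) measurable
  also have "\<dots> \<le> (\<Sum>k. ennreal ((1/2)^k))"
    by (intro suminf_le D_norm) auto
  also have "\<dots> = ennreal (\<Sum>k. (1/2)^k)"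
    by (rule suminf_ennreal2) (simp_all add: summable_geometric)
  finally have "(\<integral>\<^sup>+i. (\<Sum>k. ennreal (norm (D k i))) \<partial>unit_leb) \<noteq> \<infinity>"
    by (auto simp: top_unique)
  then have "AE i in unit_leb. (\<Sum>k. ennreal (norm (D k i))) \<noteq> \<infinity>"
    by (intro nn_integral_PInf_AE) auto
  then have conv: "AE i in unit_leb. convergent (\<lambda>k. F k i)"
  proof eventually_elim
    case (elim i)
    then have "summable (\<lambda>k. norm (D k i))"
      by (intro summable_suminf_not_top) auto
    then have "summable (\<lambda>k. D k i)"
      by (rule summable_norm_cancel)
    then have "convergent (\<lambda>k. \<Sum>j<k. D j i)"
      by (simp add: summable_iff_convergent)
    then have "convergent (\<lambda>k. F 0 i + (\<Sum>j<k. D j i))"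
      by (intro convergent_add convergent_const)
    moreover have "(\<lambda>k. F k i) = (\<lambda>k. F 0 i + (\<Sum>j<k. D j i))"
      by (rule ext) (rule F_eq)
    ultimately show ?case
      by (simp only:)
  qed
  define f where "f i = lim (\<lambda>k. F k i)" for i
  have f_meas [measurable]: "f \<in> borel_measurable unit_leb"
    unfolding f_def by (rule borel_measurable_lim_metric) measurable
  have f_lim: "AE i in unit_leb. (\<lambda>k. F k i) \<longlonglongrightarrow> f i"
    using conv by eventually_elim (simp add: f_def convergent_LIMSEQ_iff)
  have bound: "(\<integral>\<^sup>+i. ennreal ((norm (f i - F k i))\<^sup>2) \<partial>unit_leb) \<le> ennreal (((1/2)^k)\<^sup>2)" for k
  proof -
    have "AE i in unit_leb. ennreal ((norm (f i - F k i))\<^sup>2)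
            = liminf (\<lambda>j. ennreal ((norm (F j i - F k i))\<^sup>2))"
      using f_lim
    proof eventually_elim
      case (elim i)
      then have "(\<lambda>j. ennreal ((norm (F j i - F k i))\<^sup>2)) \<longlonglongrightarrow> ennreal ((norm (f i - F k i))\<^sup>2)"
        by (intro tendsto_intros)
      then show ?case
        by (intro lim_imp_Liminf[symmetric]) auto
    qed
    then have "(\<integral>\<^sup>+i. ennreal ((norm (f i - F k i))\<^sup>2) \<partial>unit_leb)
        = (\<integral>\<^sup>+i. liminf (\<lambda>j. ennreal ((norm (F j i - F k i))\<^sup>2)) \<partial>unit_leb)"
      by (rule nn_integral_cong_AE)
    also have "\<dots> \<le> liminf (\<lambda>j. \<integral>\<^sup>+i. ennreal ((norm (F j i - F k i))\<^sup>2) \<partial>unit_leb)"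
      by (rule nn_integral_liminf) measurable
    also have "\<dots> \<le> ennreal (((1/2)^k)\<^sup>2)"
    proof (rule Liminf_le[OF sequentially_bot])
      have "norm (abs_L2I (F j) - abs_L2I (F k)) < (1/2)^k" if "j \<ge> k" for j
        using N[of k "\<phi> j" "\<phi> k"] N_le[of k k] N_le[of k j] that
        by (simp add: dist_norm XF)
      then have "(\<integral>\<^sup>+i. ennreal ((norm (F j i - F k i))\<^sup>2) \<partial>unit_leb) \<le> ennreal (((1/2)^k)\<^sup>2)"
        if "j \<ge> k" for j
        unfolding nn_integral_norm_diff_L2I[OF F F] using that
        by (intro ennreal_leI power_mono norm_ge_zero) (rule less_imp_le)
      then show "\<forall>\<^sub>F j in sequentially.
          (\<integral>\<^sup>+i. ennreal ((norm (F j i - F k i))\<^sup>2) \<partial>unit_leb) \<le> ennreal (((1/2)^k)\<^sup>2)"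
        by (rule eventually_sequentiallyI[of k])
    qed
    finally show ?thesis .
  qed
  have fF: "square_int (\<lambda>i. f i - F k i)" for k
  proof (rule square_intI)
    have "(\<integral>\<^sup>+i. ennreal ((norm (f i - F k i))\<^sup>2) \<partial>unit_leb) < \<infinity>"
      using le_less_trans[OF bound[of k] ennreal_less_top] by simp
    then show "integrable unit_leb (\<lambda>i. (norm (f i - F k i))\<^sup>2)"
      by (intro integrableI_bounded) simp_all
  qed measurable
  have f: "square_int f"
    using square_int_add[OF fF[of 0] F[of 0]] by simp
  have dist_le: "dist ((X \<circ> \<phi>) k) (abs_L2I f) \<le> (1/2)^k" for k
  proof -
    have "ennreal ((norm (abs_L2I f - abs_L2I (F k)))\<^sup>2) \<le> ennreal (((1/2)^k)\<^sup>2)"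
      using bound[of k] by (simp add: nn_integral_norm_diff_L2I f F)
    then have "(norm (abs_L2I f - abs_L2I (F k)))\<^sup>2 \<le> ((1/2)^k)\<^sup>2"
      by simp
    then have "norm (abs_L2I f - abs_L2I (F k)) \<le> (1/2)^k"
      by (rule power2_le_imp_le) simp
    then show ?thesis
      by (simp add: dist_norm XF norm_minus_commute)
  qed
  have "(\<lambda>k. dist ((X \<circ> \<phi>) k) (abs_L2I f)) \<longlonglongrightarrow> 0"
  proof (rule tendsto_sandwich[OF _ _ tendsto_const])
    show "(\<lambda>k. (1/2::real)^k) \<longlonglongrightarrow> 0"
      by (rule LIMSEQ_power_zero) simp
    show "\<forall>\<^sub>F k in sequentially. 0 \<le> dist ((X \<circ> \<phi>) k) (abs_L2I f)"
      by (rule always_eventually) (blast intro: zero_le_dist)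
    show "\<forall>\<^sub>F k in sequentially. dist ((X \<circ> \<phi>) k) (abs_L2I f) \<le> (1/2)^k"
      by (rule always_eventually) (blast intro: dist_le)
  qed
  then have "(X \<circ> \<phi>) \<longlonglongrightarrow> abs_L2I f"
    by (rule iffD2[OF tendsto_dist_iff])
  then have "X \<longlonglongrightarrow> abs_L2I f"
    by (rule Cauchy_converges_subseq[OF X mono])
  then show "convergent X"
    by (rule convergentI)
qed


lift_definition L2_const :: "'b \<Rightarrow> 'b::euclidean_space L2I" is "\<lambda>c i. c"
  by (simp add: L2_rel_def square_int_const)

definition const_space :: "'b::euclidean_space L2I set"
  where "const_space = range L2_const"

lift_definition L2_mean :: "'b::euclidean_space L2I \<Rightarrow> 'b" is "\<lambda>f. \<integral>i. f i \<partial>unit_leb"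
  by (intro integral_cong_AE) (auto simp: L2_rel_def square_int_def)

definition const_perp :: "'b::euclidean_space L2I set"
  where "const_perp = {x. L2_mean x = 0}"

lemma inner_L2_const: "x \<bullet> L2_const c = L2_mean x \<bullet> c"
  by transfer (auto simp: L2_rel_def square_int_integrable intro!: integral_inner_left)

lemma const_perp_eq: "const_perp = orthogonal_comp const_space"
proof -
  have "L2_mean x = 0 \<longleftrightarrow> (\<forall>c. L2_mean x \<bullet> c = 0)" for x :: "'a L2I"
    by (metis inner_eq_zero_iff inner_zero_left)
  then show ?thesis
    by (auto simp: const_perp_def const_space_def orthogonal_comp_def orthogonal_def
        inner_L2_const inner_commute[of "L2_const _"])
qed

lemma const_perp_nonempty: "const_perp - {0 :: 'b::euclidean_space L2I} \<noteq> {}"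
proof -
  obtain c :: 'b where c: "c \<in> Basis" using nonempty_Basis by blast
  define f where "f i = indicator {0..1/2::real} i *\<^sub>R c - (1/2) *\<^sub>R c" for i
  interpret finite_measure unit_leb by (rule finite_unit_leb)
  have half: "{0..1/2::real} \<in> sets unit_leb" "measure unit_leb {0..1/2} = 1/2"
    by (auto simp: sets_restrict_space_iff measure_restrict_space)
  have norm_f: "norm (f i) = 1/2" for i
    using c by (auto simp: f_def indicator_def simp flip: scaleR_left_diff_distrib)
  have int_half: "integrable unit_leb (\<lambda>i. indicator {0..1/2::real} i *\<^sub>R c)"
    by (intro integrable_scaleR_left integrable_real_indicator half)
       (simp add: less_top[symmetric])
  have meas: "f \<in> borel_measurable unit_leb"
    unfolding f_def[abs_def] using half(1) by measurable
  have f: "square_int f"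
    using meas by (auto simp: square_int_def norm_f)
  have "integrable unit_leb (indicator {0..1/2} :: real \<Rightarrow> real)"
    by (intro integrable_real_indicator half) (simp add: less_top[symmetric])
  then have half_int: "(\<integral>i. indicator {0..1/2::real} i *\<^sub>R c \<partial>unit_leb) = (1/2) *\<^sub>R c"
    by (subst integral_scaleR_left) (simp_all add: measure_restrict_space half)
  have "(\<integral>i. f i \<partial>unit_leb) = 0"
    unfolding f_def using int_half half_int
    by (subst Bochner_Integration.integral_diff)
       (auto simp: measure_restrict_space)
  then have "abs_L2I f \<in> const_perp"
    using f by (simp add: const_perp_def L2_mean.abs_eq L2_rel_def)
  moreover have "(norm (abs_L2I f))\<^sup>2 = 1/4"
    unfolding norm_abs_L2I[OF f] norm_f by (simp add: measure_restrict_space power2_eq_square)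
  then have "abs_L2I f \<noteq> 0" by auto
  ultimately show ?thesis by blast
qed

definition lambda2 :: "('b::euclidean_space L2I \<Rightarrow>\<^sub>L 'b L2I) \<Rightarrow> real"
  where "lambda2 T = (INF x\<in>const_perp - {0}. (blinfun_apply T x \<bullet> x) / (norm x)\<^sup>2)"

text \<open>Together with \<open>const_perp_nonempty\<close>, the following shows that the infimum is a genuine one.\<close>

lemma bdd_below_lambda2:
  "bdd_below ((\<lambda>x. (blinfun_apply T x \<bullet> x) / (norm x)\<^sup>2) ` (const_perp - {0}))"
proof (rule bdd_belowI2)
  fix x :: "'a L2I" assume "x \<in> const_perp - {0}"
  then have x: "norm x > 0" by simp
  have "\<bar>blinfun_apply T x \<bullet> x\<bar> \<le> norm (blinfun_apply T x) * norm x"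
    by (rule Cauchy_Schwarz_ineq2)
  also have "\<dots> \<le> norm T * norm x * norm x"
    by (intro mult_right_mono norm_blinfun) simp
  finally have "- norm T * (norm x)\<^sup>2 \<le> blinfun_apply T x \<bullet> x"
    by (simp add: power2_eq_square abs_le_iff)
  then show "- norm T \<le> (blinfun_apply T x \<bullet> x) / (norm x)\<^sup>2"
    using x by (simp add: pos_le_divide_eq)
qed

text \<open>
  \<open>has_bochner_integral\<close> of the library requires a second countable target, which
  \<open>'b L2I \<Rightarrow>\<^sub>L 'b L2I\<close> with the operator norm is not. We use the usual definition, with
  strong measurability in place of Borel measurability.
\<close>

definition strongly_measurable :: "'a measure \<Rightarrow> ('a \<Rightarrow> 'c::real_normed_vector) \<Rightarrow> bool"
  where "strongly_measurable M f \<longleftrightarrow>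
    (\<exists>s. (\<forall>n. simple_function M (s n)) \<and> (AE x in M. (\<lambda>n. s n x) \<longlonglongrightarrow> f x))"

definition strong_bochner_integral_is ::
    "'a measure \<Rightarrow> ('a \<Rightarrow> 'c::real_normed_vector) \<Rightarrow> 'c \<Rightarrow> bool"
  where "strong_bochner_integral_is M f y \<longleftrightarrow> strongly_measurable M f \<and>
    (\<exists>s. (\<forall>n. Bochner_Integration.simple_bochner_integrable M (s n)) \<and>
         (\<lambda>n. \<integral>\<^sup>+x. ennreal (norm (f x - s n x)) \<partial>M) \<longlonglongrightarrow> 0 \<and>
         (\<lambda>n. Bochner_Integration.simple_bochner_integral M (s n)) \<longlonglongrightarrow> y)"

definition strong_bochner_integrable :: "'a measure \<Rightarrow> ('a \<Rightarrow> 'c::real_normed_vector) \<Rightarrow> bool"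
  where "strong_bochner_integrable M f \<longleftrightarrow> (\<exists>y. strong_bochner_integral_is M f y)"

definition strong_bochner_integral :: "'a measure \<Rightarrow> ('a \<Rightarrow> 'c::real_normed_vector) \<Rightarrow> 'c"
  where "strong_bochner_integral M f = (THE y. strong_bochner_integral_is M f y)"

lemma strongly_measurable_dist_simple:
  assumes f: "strongly_measurable M f" and s: "simple_function M s"
  obtains g where "g \<in> borel_measurable M" "AE x in M. ennreal (norm (f x - s x)) = g x"
proof -
  obtain t where t: "\<And>n. simple_function M (t n)" and lim: "AE x in M. (\<lambda>n. t n x) \<longlonglongrightarrow> f x"
    using f by (auto simp: strongly_measurable_def)
  define g where "g x = liminf (\<lambda>n. ennreal (norm (t n x - s x)))" for x
  have "simple_function M (\<lambda>x. ennreal (norm (t n x - s x)))" for n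
    by (rule simple_function_compose2[where h="\<lambda>u v. ennreal (norm (u - v))", OF t s])
  then have "(\<lambda>x. ennreal (norm (t n x - s x))) \<in> borel_measurable M" for n
    by (rule borel_measurable_simple_function)
  then have "g \<in> borel_measurable M"
    unfolding g_def[abs_def] by (rule borel_measurable_liminf)
  moreover have "AE x in M. ennreal (norm (f x - s x)) = g x"
    using lim
  proof eventually_elim
    case (elim x)
    then have "(\<lambda>n. ennreal (norm (t n x - s x))) \<longlonglongrightarrow> ennreal (norm (f x - s x))"
      by (intro tendsto_intros)
    then show ?case
      unfolding g_def by (intro lim_imp_Liminf[symmetric]) auto
  qed
  ultimately show ?thesis by (rule that)
qed

lemma strong_bochner_integral_unique:
  assumes y: "strong_bochner_integral_is M f y" and z: "strong_bochner_integral_is M f z"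
  shows "y = z"
proof -
  have f: "strongly_measurable M f"
    using y by (simp add: strong_bochner_integral_is_def)
  obtain s where s: "\<And>n. Bochner_Integration.simple_bochner_integrable M (s n)"
      "(\<lambda>n. \<integral>\<^sup>+x. ennreal (norm (f x - s n x)) \<partial>M) \<longlonglongrightarrow> 0"
      "(\<lambda>n. Bochner_Integration.simple_bochner_integral M (s n)) \<longlonglongrightarrow> y"
    using y by (auto simp: strong_bochner_integral_is_def)
  obtain t where t: "\<And>n. Bochner_Integration.simple_bochner_integrable M (t n)"
      "(\<lambda>n. \<integral>\<^sup>+x. ennreal (norm (f x - t n x)) \<partial>M) \<longlonglongrightarrow> 0"
      "(\<lambda>n. Bochner_Integration.simple_bochner_integral M (t n)) \<longlonglongrightarrow> z"
    using z by (auto simp: strong_bochner_integral_is_def)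
  have bound: "ennreal (norm (Bochner_Integration.simple_bochner_integral M (s n) - Bochner_Integration.simple_bochner_integral M (t n)))
      \<le> (\<integral>\<^sup>+x. ennreal (norm (f x - s n x)) \<partial>M) + (\<integral>\<^sup>+x. ennreal (norm (f x - t n x)) \<partial>M)" for n
  proof -
    have sf: "simple_function M (s n)" "simple_function M (t n)"
      using s(1)[of n] t(1)[of n] by (auto elim: simple_bochner_integrable.cases)
    obtain g where g: "g \<in> borel_measurable M" "AE x in M. ennreal (norm (f x - s n x)) = g x"
      using strongly_measurable_dist_simple[OF f sf(1)] by blast
    obtain h where h: "h \<in> borel_measurable M" "AE x in M. ennreal (norm (f x - t n x)) = h x"
      using strongly_measurable_dist_simple[OF f sf(2)] by blast
    have nint: "Bochner_Integration.simple_bochner_integrable M (\<lambda>x. norm (s n x - t n x))"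
      using simple_bochner_integrable_compose2[of "\<lambda>u v. norm (u - v)" M "s n" "t n"] s t by auto
    have "norm (Bochner_Integration.simple_bochner_integral M (s n) - Bochner_Integration.simple_bochner_integral M (t n))
        = norm (Bochner_Integration.simple_bochner_integral M (\<lambda>x. s n x - t n x))"
      using s t by (subst simple_bochner_integral_diff) auto
    also have "\<dots> \<le> Bochner_Integration.simple_bochner_integral M (\<lambda>x. norm (s n x - t n x))"
      using simple_bochner_integrable_compose2[of "(-)" M "s n" "t n"] s t
      by (intro simple_bochner_integral_norm_bound) auto
    finally have "ennreal (norm (Bochner_Integration.simple_bochner_integral M (s n) - Bochner_Integration.simple_bochner_integral M (t n)))
        \<le> ennreal (Bochner_Integration.simple_bochner_integral M (\<lambda>x. norm (s n x - t n x)))"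
      by (rule ennreal_leI)
    also have "\<dots> = (\<integral>\<^sup>+x. ennreal (norm (s n x - t n x)) \<partial>M)"
      by (rule simple_bochner_integral_eq_nn_integral[OF nint]) simp
    also have "\<dots> \<le> (\<integral>\<^sup>+x. g x + h x \<partial>M)"
    proof (rule nn_integral_mono_AE)
      show "AE x in M. ennreal (norm (s n x - t n x)) \<le> g x + h x"
        using g(2) h(2)
      proof eventually_elim
        case (elim x)
        have "norm (s n x - t n x) \<le> norm (f x - s n x) + norm (f x - t n x)"
          by (metis dual_order.refl norm_diff_triangle_le norm_minus_commute)
        then have "ennreal (norm (s n x - t n x))
            \<le> ennreal (norm (f x - s n x)) + ennreal (norm (f x - t n x))"
          by (simp flip: ennreal_plus)
        then show ?case by (simp only: elim)
      qed
    qed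
    also have "\<dots> = (\<integral>\<^sup>+x. g x \<partial>M) + (\<integral>\<^sup>+x. h x \<partial>M)"
      by (rule nn_integral_add) (use g h in auto)
    also have "\<dots> = (\<integral>\<^sup>+x. ennreal (norm (f x - s n x)) \<partial>M)
        + (\<integral>\<^sup>+x. ennreal (norm (f x - t n x)) \<partial>M)"
      using nn_integral_cong_AE[OF g(2)] nn_integral_cong_AE[OF h(2)] by (simp only:)
    finally show ?thesis .
  qed
  have "(\<lambda>n. ennreal (norm (Bochner_Integration.simple_bochner_integral M (s n) - Bochner_Integration.simple_bochner_integral M (t n))))
      \<longlonglongrightarrow> 0"
  proof (rule tendsto_sandwich[OF _ _ tendsto_const])
    show "(\<lambda>n. (\<integral>\<^sup>+x. ennreal (norm (f x - s n x)) \<partial>M) + (\<integral>\<^sup>+x. ennreal (norm (f x - t n x)) \<partial>M))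
        \<longlonglongrightarrow> 0"
      using tendsto_add[OF s(2) t(2)] by simp
  qed (use bound in \<open>auto intro!: always_eventually\<close>)
  then have "(\<lambda>n. norm (Bochner_Integration.simple_bochner_integral M (s n) - Bochner_Integration.simple_bochner_integral M (t n)))
      \<longlonglongrightarrow> 0"
    by (simp flip: ennreal_0)
  moreover have "(\<lambda>n. norm (Bochner_Integration.simple_bochner_integral M (s n) - Bochner_Integration.simple_bochner_integral M (t n)))
      \<longlonglongrightarrow> norm (y - z)"
    by (intro tendsto_intros s t)
  ultimately have "norm (y - z) = 0"
    by (rule LIMSEQ_unique[rotated])
  then show ?thesis by simp
qed

lemma strong_bochner_integral_eq:
  "strong_bochner_integral_is M f y \<Longrightarrow> strong_bochner_integral M f = y"
  unfolding strong_bochner_integral_def by (blast intro: strong_bochner_integral_unique)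

text \<open>Elements of \<open>L\<^sup>2\<^sub>l\<^sub>o\<^sub>c(A, X)\<close> are given by representatives; their values outside \<open>A\<close> are irrelevant.\<close>

definition L2_loc :: "real set \<Rightarrow> (real \<Rightarrow> 'c::real_normed_vector) set"
  where "L2_loc A = {f. strongly_measurable (lebesgue_on A) f \<and>
    (\<forall>K. compact K \<and> K \<subseteq> A \<longrightarrow> integrable (lebesgue_on K) (\<lambda>s. (norm (f s))\<^sup>2))}"

end

theory Submission
  imports Defs
begin

text \<open>
  As an infimum of functionals linear in \<open>T\<close> that are bounded by \<open>norm T\<close>, \<open>lambda2\<close> is concave and
  1-Lipschitz. Hence \<open>lambda2 \<circ> T\<close> inherits measurability and integrability from \<open>T\<close>. For Jensen's
  inequality no separation argument is needed: each Rayleigh quotient commutes with the Bochner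
  integral and dominates \<open>lambda2\<close>, so one integrates first and takes the infimum afterwards.
\<close>

section \<open>Completeness and strong measurability\<close>

text \<open>Preimages under \<open>f\<close> and \<open>g\<close> differ by a subset of a null set,
  which completeness makes measurable. As the equality may fail on a null set, that \<open>f\<close>
  maps into \<open>space N\<close> is a separate hypothesis.\<close>

lemma (in complete_measure) measurable_cong_AE:
  assumes g: "g \<in> measurable M N" and eq: "AE x in M. f x = g x"
    and f: "f \<in> space M \<rightarrow> space N"
  shows "f \<in> measurable M N"
proof (rule measurableI)
  fix A assume "A \<in> sets N"
  then have A: "g -` A \<inter> space M \<in> sets M"
    by (rule measurable_sets[OF g])
  have "AE x in M. x \<in> g -` A \<inter> space M \<longleftrightarrow> x \<in> f -` A \<inter> space M"
    using eq AE_space by eventually_elim simp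
  then show "f -` A \<inter> space M \<in> sets M"
    using A by (rule in_sets_AE) simp
qed (use f in auto)

text \<open>A null set of the restricted measure is Lebesgue null, and Lebesgue measure is complete.
  This matters because \<open>strongly_measurable\<close> only asks for convergence almost
  everywhere.\<close>

lemma complete_measure_lebesgue_on:
  assumes S: "S \<in> sets lebesgue"
  shows "complete_measure (lebesgue_on S)"
proof
  fix A B :: "'a set"
  assume BA: "B \<subseteq> A" and A: "A \<in> null_sets (lebesgue_on S)"
  have "A \<subseteq> S"
    using sets.sets_into_space[of A "lebesgue_on S"] A by (auto simp: null_sets_def)
  moreover have "A \<in> null_sets lebesgue"
    using A S by (auto simp: null_sets_def sets_restrict_space_iff emeasure_restrict_space)
  then have "B \<in> sets lebesgue"
    using BA by (rule completion.complete[rotated])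
  ultimately show "B \<in> sets (lebesgue_on S)"
    using BA S by (auto simp: sets_restrict_space_iff)
qed

text \<open>Any map sends simple functions to simple functions; continuity serves to pass to the
  limit. The instances used later are \<open>norm\<close>, bounded linear maps and
  \<open>lambda2\<close>.\<close>

lemma strongly_measurable_compose:
  assumes f: "strongly_measurable M f" and g: "continuous_on UNIV g"
  shows "strongly_measurable M (\<lambda>x. g (f x))"
proof -
  obtain s where s: "\<And>n. simple_function M (s n)" "AE x in M. (\<lambda>n. s n x) \<longlonglongrightarrow> f x"
    using f by (auto simp: strongly_measurable_def)
  have "simple_function M (\<lambda>x. g (s n x))" for n
    by (rule simple_function_compose1[OF s(1)])
  moreover have "AE x in M. (\<lambda>n. g (s n x)) \<longlonglongrightarrow> g (f x)"
    using s(2) by eventually_elim (rule continuous_on_tendsto_compose[OF g], auto)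
  ultimately show ?thesis
    unfolding strongly_measurable_def by (intro exI[of _ "\<lambda>n x. g (s n x)"]) simp
qed

lemma strongly_measurable_diff_simple:
  assumes f: "strongly_measurable M f" and u: "simple_function M u"
  shows "strongly_measurable M (\<lambda>x. f x - u x)"
proof -
  obtain s where s: "\<And>n. simple_function M (s n)" "AE x in M. (\<lambda>n. s n x) \<longlonglongrightarrow> f x"
    using f by (auto simp: strongly_measurable_def)
  have "simple_function M (\<lambda>x. s n x - u x)" for n
    by (rule simple_function_compose2[OF s(1) u])
  moreover have "AE x in M. (\<lambda>n. s n x - u x) \<longlonglongrightarrow> f x - u x"
    using s(2) by eventually_elim (intro tendsto_intros)
  ultimately show ?thesis
    unfolding strongly_measurable_def by (intro exI[of _ "\<lambda>n x. s n x - u x"]) simp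
qed

lemma strongly_measurable_lebesgue_on_subset:
  assumes f: "strongly_measurable (lebesgue_on A) f"
    and A: "A \<in> sets lebesgue" and B: "B \<in> sets lebesgue" and sub: "B \<subseteq> A"
  shows "strongly_measurable (lebesgue_on B) f"
proof -
  obtain s where s: "\<And>n. simple_function (lebesgue_on A) (s n)"
      "AE x in lebesgue_on A. (\<lambda>n. s n x) \<longlonglongrightarrow> f x"
    using f by (auto simp: strongly_measurable_def)
  have "simple_function (lebesgue_on B) (s n)" for n
    unfolding simple_function_def
  proof safe
    show "finite (s n ` space (lebesgue_on B))"
      using s(1)[of n] sub by (auto simp: simple_function_def intro: finite_subset[OF image_mono])
    fix x assume "x \<in> space (lebesgue_on B)"
    then have "s n -` {s n x} \<inter> A \<in> sets lebesgue"
      using s(1)[of n] sub A by (auto simp: simple_function_def sets_restrict_space_iff)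
    \<comment> \<open>Level sets of \<open>s n\<close> are measurable only within \<open>A\<close>,
      so the level set on \<open>B\<close> is written as an intersection with
      \<open>B\<close>.\<close>
    then have "(s n -` {s n x} \<inter> A) \<inter> B \<in> sets lebesgue"
      using B by (rule sets.Int)
    also have "(s n -` {s n x} \<inter> A) \<inter> B = s n -` {s n x} \<inter> B"
      using sub by auto
    finally show "s n -` {s n x} \<inter> space (lebesgue_on B) \<in> sets (lebesgue_on B)"
      using B by (auto simp: sets_restrict_space_iff)
  qed
  moreover have "AE x in lebesgue_on B. (\<lambda>n. s n x) \<longlonglongrightarrow> f x"
    using s(2) A B sub by (auto simp: AE_restrict_space_iff elim: eventually_mono)
  ultimately show ?thesis
    unfolding strongly_measurable_def by blast
qed

text \<open>The everywhere-defined \<open>lim\<close> of the simple functions is Borel and agrees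
  with \<open>f\<close> almost everywhere; completeness transfers measurability to
  \<open>f\<close>.\<close>

lemma (in complete_measure) strongly_measurable_imp_borel_measurable:
  fixes f :: "'a \<Rightarrow> 'c::{banach, second_countable_topology}"
  assumes "strongly_measurable M f"
  shows "f \<in> borel_measurable M"
proof -
  obtain s where s: "\<And>n. simple_function M (s n)" "AE x in M. (\<lambda>n. s n x) \<longlonglongrightarrow> f x"
    using assms by (auto simp: strongly_measurable_def)
  have "(\<lambda>x. lim (\<lambda>n. s n x)) \<in> borel_measurable M"
    by (intro borel_measurable_lim_metric borel_measurable_simple_function s)
  moreover have "AE x in M. f x = lim (\<lambda>n. s n x)"
    using s(2) by eventually_elim (simp add: limI)
  ultimately show ?thesis
    by (rule measurable_cong_AE) simp
qed

text \<open>The distance is real-valued, so it is Borel measurable even when the target of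
  \<open>f\<close> is not separable, as for operators. All integral estimates below work with such
  distances.\<close>

lemma (in complete_measure) borel_measurable_norm_diff_simple:
  assumes "strongly_measurable M f" "simple_function M u"
  shows "(\<lambda>x. norm (f x - u x)) \<in> borel_measurable M"
  by (intro strongly_measurable_imp_borel_measurable
      strongly_measurable_compose[OF strongly_measurable_diff_simple[OF assms]] continuous_intros)

section \<open>Existence of the Bochner integral and its images under bounded linear maps\<close>

text \<open>Triangle inequality through \<open>f\<close>. It turns L1 approximation of
  \<open>f\<close> into the Cauchy property of the approximating integrals.\<close>

lemma (in complete_measure) norm_simple_bochner_integral_diff_le:
  assumes f: "strongly_measurable M f"
    and s: "Bochner_Integration.simple_bochner_integrable M s"
    and t: "Bochner_Integration.simple_bochner_integrable M t"
  shows "ennreal (norm (Bochner_Integration.simple_bochner_integral M s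
        - Bochner_Integration.simple_bochner_integral M t))
      \<le> (\<integral>\<^sup>+x. ennreal (norm (f x - s x)) \<partial>M) + (\<integral>\<^sup>+x. ennreal (norm (f x - t x)) \<partial>M)"
proof -
  have [measurable]: "(\<lambda>x. norm (f x - s x)) \<in> borel_measurable M"
      "(\<lambda>x. norm (f x - t x)) \<in> borel_measurable M"
    using s t by (auto intro!: borel_measurable_norm_diff_simple f
        elim: simple_bochner_integrable.cases)
  have nint: "Bochner_Integration.simple_bochner_integrable M (\<lambda>x. norm (s x - t x))"
    using simple_bochner_integrable_compose2[of "\<lambda>u v. norm (u - v)" M s t] s t by auto
  have "norm (Bochner_Integration.simple_bochner_integral M s
        - Bochner_Integration.simple_bochner_integral M t)
      = norm (Bochner_Integration.simple_bochner_integral M (\<lambda>x. s x - t x))"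
    using s t by (subst simple_bochner_integral_diff) auto
  also have "\<dots> \<le> Bochner_Integration.simple_bochner_integral M (\<lambda>x. norm (s x - t x))"
    using simple_bochner_integrable_compose2[of "(-)" M s t] s t
    by (intro simple_bochner_integral_norm_bound) auto
  finally have "ennreal (norm (Bochner_Integration.simple_bochner_integral M s
        - Bochner_Integration.simple_bochner_integral M t))
      \<le> ennreal (Bochner_Integration.simple_bochner_integral M (\<lambda>x. norm (s x - t x)))"
    by (rule ennreal_leI)
  also have "\<dots> = (\<integral>\<^sup>+x. ennreal (norm (s x - t x)) \<partial>M)"
    by (rule simple_bochner_integral_eq_nn_integral[OF nint]) simp
  also have "\<dots> \<le> (\<integral>\<^sup>+x. ennreal (norm (f x - s x)) + ennreal (norm (f x - t x)) \<partial>M)"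
  proof (rule nn_integral_mono)
    fix x
    have "norm (s x - t x) \<le> norm (f x - s x) + norm (f x - t x)"
      by (metis dual_order.refl norm_diff_triangle_le norm_minus_commute)
    then show "ennreal (norm (s x - t x)) \<le> ennreal (norm (f x - s x)) + ennreal (norm (f x - t x))"
      by (simp flip: ennreal_plus)
  qed
  also have "\<dots> = (\<integral>\<^sup>+x. ennreal (norm (f x - s x)) \<partial>M) + (\<integral>\<^sup>+x. ennreal (norm (f x - t x)) \<partial>M)"
    by (rule nn_integral_add) measurable
  finally show ?thesis .
qed

text \<open>Bochner's criterion: dominated convergence gives simple functions converging to
  \<open>f\<close> in L1, and completeness of the target gives a limit of their integrals.\<close>

lemma (in complete_measure) strong_bochner_integrableI:
  fixes f :: "'a \<Rightarrow> 'c::banach"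
  assumes f: "strongly_measurable M f" and int: "integrable M (\<lambda>x. norm (f x))"
  shows "strong_bochner_integrable M f"
proof -
  obtain s where s: "\<And>n. simple_function M (s n)" "AE x in M. (\<lambda>n. s n x) \<longlonglongrightarrow> f x"
    using f by (auto simp: strongly_measurable_def)
  note [measurable] = borel_measurable_integrable[OF int]
  have fin: "(\<integral>\<^sup>+x. ennreal (norm (f x)) \<partial>M) < \<infinity>"
    using int by (simp add: integrable_iff_bounded)
  have fin_mult: "(\<integral>\<^sup>+x. ennreal (c * norm (f x)) \<partial>M) < \<infinity>" if "c \<ge> 0" for c
    using fin that by (simp add: ennreal_mult' nn_integral_cmult ennreal_mult_less_top)
  \<comment> \<open>Cutting off where \<open>s n\<close> exceeds \<open>2 * norm f\<close> keeps pointwise convergence and adds domination.\<close>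
  define u where "u n x = (if norm (s n x) \<le> 2 * norm (f x) then s n x else 0)" for n x
  have [measurable]: "(\<lambda>x. norm (s n x)) \<in> borel_measurable M" for n
    by (intro borel_measurable_simple_function simple_function_compose1[OF s(1)])
  have u: "simple_function M (u n)" for n
    unfolding u_def[abs_def] by (intro simple_function_If s) measurable
  have u_le: "norm (u n x) \<le> 2 * norm (f x)" for n x
    by (simp add: u_def)
  have u_lim: "AE x in M. (\<lambda>n. norm (f x - u n x)) \<longlonglongrightarrow> 0"
    using s(2)
  proof eventually_elim
    case (elim x)
    have "(\<lambda>n. u n x) \<longlonglongrightarrow> f x"
    \<comment> \<open>If \<open>f x = 0\<close>, the cutoff forces \<open>u n x = 0\<close>.
      Otherwise \<open>norm (s n x)\<close> tends to \<open>norm (f x) < 2 * norm (f x)\<close>, so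
      the cutoff is eventually inactive.\<close>
    proof (cases "f x = 0")
      case True
      then have "u n x = 0" for n
        using u_le[of n x] by simp
      then show ?thesis
        using True by simp
    next
      case False
      have "\<forall>\<^sub>F n in sequentially. norm (s n x) < 2 * norm (f x)"
        by (rule order_tendstoD(2)[OF tendsto_norm[OF elim]]) (use False in simp)
      then have "\<forall>\<^sub>F n in sequentially. s n x = u n x"
        by eventually_elim (simp add: u_def)
      then show ?thesis
        using elim by (rule Lim_transform_eventually[rotated])
    qed
    then show ?case
      using tendsto_norm[OF tendsto_diff[OF tendsto_const[of "f x"]]] by fastforce
  qed
  have ui: "Bochner_Integration.simple_bochner_integrable M (u n)" for n
  proof (rule simple_bochner_integrableI_bounded[OF u])
    have "(\<integral>\<^sup>+x. ennreal (norm (u n x)) \<partial>M) \<le> (\<integral>\<^sup>+x. ennreal (2 * norm (f x)) \<partial>M)"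
      by (intro nn_integral_mono ennreal_leI u_le)
    then show "(\<integral>\<^sup>+x. ennreal (norm (u n x)) \<partial>M) < \<infinity>"
      using fin_mult[of 2] by simp
  qed
  \<comment> \<open>Dominated convergence is applied to the real functions
    \<open>norm (f x - u n x)\<close> with limit 0. The factor 3 in the dominating function is 1 for
    \<open>f\<close> plus 2 for the cutoff \<open>u n\<close>.\<close>
  have "(\<lambda>n. \<integral>\<^sup>+x. ennreal (norm (0 - norm (f x - u n x))) \<partial>M) \<longlonglongrightarrow> 0"
  proof (rule nn_integral_dominated_convergence_norm[where w="\<lambda>x. 3 * norm (f x)"])
    show "(\<lambda>x. norm (f x - u n x)) \<in> borel_measurable M" for n
      by (rule borel_measurable_norm_diff_simple[OF f u])
    show "AE x in M. norm (norm (f x - u n x)) \<le> 3 * norm (f x)" for n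
    proof (rule AE_I2)
      fix x
      show "norm (norm (f x - u n x)) \<le> 3 * norm (f x)"
        using norm_triangle_ineq4[of "f x" "u n x"] u_le[of n x] by simp
    qed
  qed (use fin_mult[of 3] u_lim in auto)
  then have lim: "(\<lambda>n. \<integral>\<^sup>+x. ennreal (norm (f x - u n x)) \<partial>M) \<longlonglongrightarrow> 0"
    by simp
  define I where "I n = Bochner_Integration.simple_bochner_integral M (u n)" for n
  have "Cauchy I"
  proof (rule CauchyI)
    fix e :: real assume e: "0 < e"
    then have "\<forall>\<^sub>F n in sequentially. (\<integral>\<^sup>+x. ennreal (norm (f x - u n x)) \<partial>M) < ennreal (e / 2)"
      by (intro order_tendstoD(2)[OF lim]) simp
    then obtain N where N: "\<And>n. n \<ge> N \<Longrightarrow> (\<integral>\<^sup>+x. ennreal (norm (f x - u n x)) \<partial>M) < ennreal (e / 2)"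
      by (auto simp: eventually_sequentially)
    have "norm (I m - I n) < e" if "m \<ge> N" "n \<ge> N" for m n
    proof -
      have "ennreal (norm (I m - I n))
          \<le> (\<integral>\<^sup>+x. ennreal (norm (f x - u m x)) \<partial>M) + (\<integral>\<^sup>+x. ennreal (norm (f x - u n x)) \<partial>M)"
        unfolding I_def by (rule norm_simple_bochner_integral_diff_le[OF f ui ui])
      also have "\<dots> < ennreal (e / 2) + ennreal (e / 2)"
        by (intro add_strict_mono N that)
      also have "\<dots> = ennreal e"
        using e by (simp flip: ennreal_plus)
      finally show ?thesis
        by (simp add: ennreal_less_iff)
    qed
    then show "\<exists>N. \<forall>m\<ge>N. \<forall>n\<ge>N. norm (I m - I n) < e"
      by blast
  qed
  then obtain y where "I \<longlonglongrightarrow> y"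
    using Cauchy_convergent convergent_def by blast
  then show ?thesis
    unfolding strong_bochner_integrable_def strong_bochner_integral_is_def I_def
    using f ui lim by blast
qed

text \<open>If simple functions \<open>s n\<close> approximate \<open>f\<close> in L1, then their
  images under \<open>\<phi>\<close> approximate \<open>\<phi> (f x)\<close>, with errors enlarged
  by at most a constant factor. Scalar test functionals thus reduce the operator-valued integral to
  ordinary integrals.\<close>

lemma (in complete_measure) has_bochner_integral_bounded_linear_strong:
  fixes \<phi> :: "'c::real_normed_vector \<Rightarrow> 'd::{banach, second_countable_topology}"
  assumes y: "strong_bochner_integral_is M f y" and "bounded_linear \<phi>"
  shows "has_bochner_integral M (\<lambda>x. \<phi> (f x)) (\<phi> y)"
proof -
  interpret \<phi>: bounded_linear \<phi> by fact
  have f: "strongly_measurable M f"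
    using y by (simp add: strong_bochner_integral_is_def)
  obtain s where s: "\<And>n. Bochner_Integration.simple_bochner_integrable M (s n)"
      "(\<lambda>n. \<integral>\<^sup>+x. ennreal (norm (f x - s n x)) \<partial>M) \<longlonglongrightarrow> 0"
      "(\<lambda>n. Bochner_Integration.simple_bochner_integral M (s n)) \<longlonglongrightarrow> y"
    using y by (auto simp: strong_bochner_integral_is_def)
  have [measurable]: "(\<lambda>x. norm (f x - s n x)) \<in> borel_measurable M" for n
    using s(1)[of n] by (auto intro!: borel_measurable_norm_diff_simple f
        elim: simple_bochner_integrable.cases)
  obtain K where K: "K > 0" "\<And>x n. norm (\<phi> (f x) - \<phi> (s n x)) \<le> norm (f x - s n x) * K"
    using \<phi>.pos_bounded by (auto simp: \<phi>.diff[symmetric])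
  show ?thesis
  proof (rule has_bochner_integral.intros)
    show "(\<lambda>x. \<phi> (f x)) \<in> borel_measurable M"
      by (intro strongly_measurable_imp_borel_measurable strongly_measurable_compose[OF f]
          \<phi>.continuous_on continuous_on_id)
    show "Bochner_Integration.simple_bochner_integrable M (\<lambda>x. \<phi> (s n x))" for n
      using s(1)[of n] by (auto intro: simple_bochner_integrable_compose2 \<phi>.zero)
    show "(\<lambda>n. \<integral>\<^sup>+x. ennreal (norm (\<phi> (f x) - \<phi> (s n x))) \<partial>M) \<longlonglongrightarrow> 0"
    proof (rule tendsto_sandwich[OF _ _ tendsto_const])
      have "(\<integral>\<^sup>+x. ennreal (norm (\<phi> (f x) - \<phi> (s n x))) \<partial>M)
          \<le> ennreal K * (\<integral>\<^sup>+x. ennreal (norm (f x - s n x)) \<partial>M)" for n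
      proof -
        have "(\<integral>\<^sup>+x. ennreal (norm (\<phi> (f x) - \<phi> (s n x))) \<partial>M)
            \<le> (\<integral>\<^sup>+x. ennreal K * ennreal (norm (f x - s n x)) \<partial>M)"
          using K by (intro nn_integral_mono) (auto simp: ac_simps ennreal_mult[symmetric])
        also have "\<dots> = ennreal K * (\<integral>\<^sup>+x. ennreal (norm (f x - s n x)) \<partial>M)"
          by (intro nn_integral_cmult) measurable
        finally show ?thesis .
      qed
      then show "\<forall>\<^sub>F n in sequentially. (\<integral>\<^sup>+x. ennreal (norm (\<phi> (f x) - \<phi> (s n x))) \<partial>M)
          \<le> ennreal K * (\<integral>\<^sup>+x. ennreal (norm (f x - s n x)) \<partial>M)"
        by simp
      show "(\<lambda>n. ennreal K * (\<integral>\<^sup>+x. ennreal (norm (f x - s n x)) \<partial>M)) \<longlonglongrightarrow> 0"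
        using ennreal_tendsto_cmult[OF _ s(2), of "ennreal K"] by simp
    qed simp
    show "(\<lambda>n. Bochner_Integration.simple_bochner_integral M (\<lambda>x. \<phi> (s n x))) \<longlonglongrightarrow> \<phi> y"
      using \<phi>.tendsto[OF s(3)] s(1)
      by (simp add: simple_bochner_integral_linear \<phi>.linear_axioms)
  qed
qed

section \<open>Concavity and Lipschitz continuity of \<open>lambda2\<close>\<close>

lemma lambda2_le:
  "x \<in> const_perp - {0} \<Longrightarrow> lambda2 T \<le> (blinfun_apply T x \<bullet> x) / (norm x)\<^sup>2"
  unfolding lambda2_def by (rule cINF_lower[OF bdd_below_lambda2])

lemma lambda2_greatest:
  assumes "\<And>x. x \<in> const_perp - {0} \<Longrightarrow> m \<le> (blinfun_apply T x \<bullet> x) / (norm x)\<^sup>2"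
  shows "m \<le> lambda2 T"
  unfolding lambda2_def by (rule cINF_greatest[OF const_perp_nonempty assms])

lemma concave_on_lambda2: "concave_on UNIV lambda2"
  unfolding concave_on_iff
proof (intro conjI ballI allI impI)
  fix S T :: "'a L2I \<Rightarrow>\<^sub>L 'a L2I" and u v :: real
  assume uv: "0 \<le> u" "0 \<le> v"
  show "u * lambda2 S + v * lambda2 T \<le> lambda2 (u *\<^sub>R S + v *\<^sub>R T)"
  proof (rule lambda2_greatest)
    fix x :: "'a L2I" assume x: "x \<in> const_perp - {0}"
    have "u * lambda2 S + v * lambda2 T
        \<le> u * ((S x \<bullet> x) / (norm x)\<^sup>2) + v * ((T x \<bullet> x) / (norm x)\<^sup>2)"
      by (intro add_mono mult_left_mono lambda2_le x uv)
    also have "\<dots> = ((u *\<^sub>R S + v *\<^sub>R T) x \<bullet> x) / (norm x)\<^sup>2"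
      by (simp add: plus_blinfun.rep_eq scaleR_blinfun.rep_eq inner_add_left add_divide_distrib)
    finally show "u * lambda2 S + v * lambda2 T \<le> ((u *\<^sub>R S + v *\<^sub>R T) x \<bullet> x) / (norm x)\<^sup>2" .
  qed
qed simp

lemma rayleigh_quotient_le_norm:
  fixes T :: "'a::real_inner \<Rightarrow>\<^sub>L 'a"
  shows "(blinfun_apply T x \<bullet> x) / (norm x)\<^sup>2 \<le> norm T"
\<comment> \<open>For \<open>x = 0\<close> the quotient is 0 by the convention on division by zero;
  otherwise Cauchy-Schwarz applies.\<close>
proof (cases "x = 0")
  case False
  have "T x \<bullet> x \<le> norm (T x) * norm x"
    by (rule norm_cauchy_schwarz)
  also have "\<dots> \<le> norm T * norm x * norm x"
    by (intro mult_right_mono norm_blinfun) simp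
  finally show ?thesis
    using False by (simp add: pos_divide_le_eq power2_eq_square mult.assoc)
qed simp

text \<open>The Rayleigh quotient of \<open>T\<close> is that of \<open>S\<close> minus that of
  \<open>S - T\<close>, and the latter is at most \<open>norm (S - T)\<close>. Exchanging
  \<open>S\<close> and \<open>T\<close> gives the Lipschitz bound.\<close>

lemma lambda2_le_add_norm_diff: "lambda2 S - norm (S - T) \<le> lambda2 T"
proof (rule lambda2_greatest)
  fix x :: "'a L2I" assume x: "x \<in> const_perp - {0}"
  have "lambda2 S - norm (S - T) \<le> (S x \<bullet> x) / (norm x)\<^sup>2 - ((S - T) x \<bullet> x) / (norm x)\<^sup>2"
    by (intro diff_mono lambda2_le[OF x] rayleigh_quotient_le_norm)
  also have "\<dots> = (T x \<bullet> x) / (norm x)\<^sup>2"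
    by (simp add: minus_blinfun.rep_eq inner_diff_left diff_divide_distrib)
  finally show "lambda2 S - norm (S - T) \<le> (T x \<bullet> x) / (norm x)\<^sup>2" .
qed

lemma abs_lambda2_diff_le: "\<bar>lambda2 S - lambda2 T\<bar> \<le> norm (S - T)"
  using lambda2_le_add_norm_diff[of S T] lambda2_le_add_norm_diff[of T S]
  by (simp add: norm_minus_commute)

lemma continuous_on_lambda2: "continuous_on UNIV lambda2"
proof (rule lipschitz_on_continuous_on)
  show "1-lipschitz_on UNIV lambda2"
    using abs_lambda2_diff_le by (intro lipschitz_onI) (auto simp: dist_norm)
qed

lemma abs_lambda2_le: "\<bar>lambda2 T\<bar> \<le> norm T"
proof -
  \<comment> \<open>Here the infimum is of the constant 0 over a nonempty set, so comparison with
    the zero operator yields the norm bound.\<close>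
  have "lambda2 (0 :: 'a L2I \<Rightarrow>\<^sub>L 'a L2I) = 0"
    unfolding lambda2_def zero_blinfun.rep_eq inner_zero_left div_0
    by (rule cINF_const[OF const_perp_nonempty])
  then show ?thesis
    using abs_lambda2_diff_le[of T 0] by simp
qed

section \<open>Integration of \<open>lambda2\<close> along an operator-valued function\<close>

lemma (in complete_measure) integrable_lambda2:
  assumes "strongly_measurable M T" "integrable M (\<lambda>s. norm (T s))"
  shows "integrable M (\<lambda>s. lambda2 (T s))"
proof (rule Bochner_Integration.integrable_bound[OF assms(2)])
  show "(\<lambda>s. lambda2 (T s)) \<in> borel_measurable M"
    by (intro strongly_measurable_imp_borel_measurable
        strongly_measurable_compose[OF assms(1) continuous_on_lambda2])
qed (simp add: abs_lambda2_le)

text \<open>Each fixed test vector \<open>x\<close> gives an upper bound for the left-hand side, and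
  the infimum over \<open>x\<close> follows. The factor \<open>c\<close> becomes
  \<open>1 / \<tau>\<close> in the application.\<close>

lemma (in complete_measure) integral_lambda2_le:
  assumes y: "strong_bochner_integral_is M T y" and int: "integrable M (\<lambda>s. lambda2 (T s))"
    and c: "0 \<le> c"
  shows "c * (\<integral>s. lambda2 (T s) \<partial>M) \<le> lambda2 (c *\<^sub>R y)"
proof (rule lambda2_greatest)
  fix x :: "'b L2I" assume x: "x \<in> const_perp - {0}"
  define \<phi> where "\<phi> S = (blinfun_apply S x \<bullet> x) / (norm x)\<^sup>2" for S :: "'b L2I \<Rightarrow>\<^sub>L 'b L2I"
  \<comment> \<open>With \<open>x\<close> fixed, the denominator is a constant, and
    \<open>\<phi>\<close> is evaluation at \<open>x\<close>, then inner product with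
    \<open>x\<close>, then scaling.\<close>
  have "bounded_linear \<phi>"
    unfolding \<phi>_def[abs_def] divide_inverse
    by (intro bounded_linear_mult_const bounded_linear_inner_left_comp
        bounded_linear_intros)
  note \<phi> = has_bochner_integral_bounded_linear_strong[OF y this]
  have "(\<integral>s. lambda2 (T s) \<partial>M) \<le> (\<integral>s. \<phi> (T s) \<partial>M)"
    using int \<phi> by (intro integral_mono) (auto simp: \<phi>_def lambda2_le[OF x] intro: integrable.intros)
  also have "\<dots> = \<phi> y"
    using \<phi> by (rule has_bochner_integral_integral_eq)
  finally have "c * (\<integral>s. lambda2 (T s) \<partial>M) \<le> c * \<phi> y"
    using c by (rule mult_left_mono)
  then show "c * (\<integral>s. lambda2 (T s) \<partial>M) \<le> ((c *\<^sub>R y) x \<bullet> x) / (norm x)\<^sup>2"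
    by (simp add: \<phi>_def scaleR_blinfun.rep_eq)
qed

text \<open>On a compact set the measure is finite, so square integrability of the norm implies
  integrability.\<close>

lemma L2_loc_integrable_norm:
  assumes T: "T \<in> L2_loc A" and A: "A \<in> sets lebesgue" and K: "compact K" "K \<subseteq> A"
  shows "strongly_measurable (lebesgue_on K) T" "integrable (lebesgue_on K) (\<lambda>s. norm (T s))"
proof -
  have "K \<in> lmeasurable"
    using K(1) by (rule lmeasurable_compact)
  then have K': "K \<in> sets lebesgue" and fin: "finite_measure (lebesgue_on K)"
    by (blast, rule finite_measure_lebesgue_on)
  interpret complete_measure "lebesgue_on K"
    using K' by (rule complete_measure_lebesgue_on)
  show T': "strongly_measurable (lebesgue_on K) T"
    using T by (intro strongly_measurable_lebesgue_on_subset[OF _ A K' K(2)]) (simp add: L2_loc_def)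
  show "integrable (lebesgue_on K) (\<lambda>s. norm (T s))"
  proof (rule Bochner_Integration.integrable_bound)
    show "integrable (lebesgue_on K) (\<lambda>s. (norm (T s))\<^sup>2 + 1)"
      using T K by (intro Bochner_Integration.integrable_add finite_measure.integrable_const[OF fin])
        (simp add: L2_loc_def)
    show "(\<lambda>s. norm (T s)) \<in> borel_measurable (lebesgue_on K)"
      by (intro strongly_measurable_imp_borel_measurable strongly_measurable_compose[OF T']
          continuous_intros)
    \<comment> \<open>With \<open>a = norm (T s)\<close>, this is
      \<open>a\<^sup>2 - a + 1 = (a - 1)\<^sup>2 + a \<ge> 0\<close>.\<close>
    have "norm (T s) \<le> (norm (T s))\<^sup>2 + 1" for s
    proof -
      have "0 \<le> (norm (T s) - 1)\<^sup>2 + norm (T s)" by simp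
      then show ?thesis by (simp add: power2_diff)
    qed
    then show "AE s in lebesgue_on K. norm (norm (T s)) \<le> norm ((norm (T s))\<^sup>2 + 1)"
      by (intro AE_I2) (simp add: abs_of_nonneg add_nonneg_nonneg)
  qed
qed

text \<open>The two integrability clauses guarantee that both integrals in the inequality are
  genuine, rather than the values that \<open>integral\<close> and \<open>THE\<close> take when no
  integral exists.\<close>

theorem proposition4p12:
  shows "concave_on UNIV (lambda2 :: ((real ^ 'd) L2I \<Rightarrow>\<^sub>L (real ^ 'd) L2I) \<Rightarrow> real) \<and>
    (\<forall>T :: real \<Rightarrow> ((real ^ 'd) L2I \<Rightarrow>\<^sub>L (real ^ 'd) L2I). \<forall>\<tau> > 0. T \<in> L2_loc {0..} \<longrightarrow>
      (\<forall>t \<ge> 0.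
        strong_bochner_integrable (lebesgue_on {t..t + \<tau>}) T \<and>
        integrable (lebesgue_on {t..t + \<tau>}) (\<lambda>s. lambda2 (T s)) \<and>
        (1 / \<tau>) * (\<integral>s. lambda2 (T s) \<partial>(lebesgue_on {t..t + \<tau>}))
          \<le> lambda2 ((1 / \<tau>) *\<^sub>R strong_bochner_integral (lebesgue_on {t..t + \<tau>}) T)))"
proof (intro conjI allI impI concave_on_lambda2)
  fix T :: "real \<Rightarrow> ((real ^ 'd) L2I \<Rightarrow>\<^sub>L (real ^ 'd) L2I)" and \<tau> t :: real
  assume \<tau>: "0 < \<tau>" and T: "T \<in> L2_loc {0..}" and t: "0 \<le> t"
  let ?M = "lebesgue_on {t..t + \<tau>}"
  interpret complete_measure ?M
    by (rule complete_measure_lebesgue_on) simp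
  \<comment> \<open>Since \<open>t \<ge> 0\<close>, the interval is a compact subset of
    \<open>{0..}\<close>, where local square integrability applies.\<close>
  have T': "strongly_measurable ?M T" "integrable ?M (\<lambda>s. norm (T s))"
    using t by (auto intro!: L2_loc_integrable_norm[OF T])
  show "strong_bochner_integrable ?M T"
    by (rule strong_bochner_integrableI[OF T'])
  then have "strong_bochner_integral_is ?M T (strong_bochner_integral ?M T)"
    by (auto simp: strong_bochner_integrable_def strong_bochner_integral_eq)
  moreover show "integrable ?M (\<lambda>s. lambda2 (T s))"
    by (rule integrable_lambda2[OF T'])
  ultimately show "(1 / \<tau>) * (\<integral>s. lambda2 (T s) \<partial>?M)
      \<le> lambda2 ((1 / \<tau>) *\<^sub>R strong_bochner_integral ?M T)"
    using \<tau> by (intro integral_lambda2_le) auto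
qed

end
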